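(* Let $n\ge 2$ and let $\mathcal V_n$ be the real nilpotent Lie algebra with basis $e_1,\dots,e_n$ and commutation relations $[e_i,e_j]=(j-i)e_{i+j}$ if $i+j\le n$ and $[e_i,e_j]=0$ if $i+j>n$. Let $x_1,\dots,x_n$ be the corresponding linear coordinates on $\mathcal V_n^*$. The orbits of the coadjoint representation in $\mathcal V_n^*$ are described as follows: 1) for $n=2q+2$ with $q\ge1$, the orbits contained in $\{x_{2q+2}\ne 0\}$ are the (joint) level surfaces $\{f_1=c_1,\ f_2=c_2\}$, $c_1\neq 0$, $c_2\in\mathbb R$, of the polynomials $f_1=x_{2q+2}$ and $f_2=F_{2q+2}$, where $F_{2q+2}$ is the polynomial defined in the context; moreover, for $x_{2q+2}=0$ the polynomial $F_{2q+2}$ is equal to $\mathrm{const}\cdot x_{2q+1}^{q+1}$; 2) for $n=2q+1$ with $q\ge1$, the orbits contained in $\{x_{2q+1}\neq0\}$ are the hyperplanes $x_{2q+1}=\mathrm{const}\ne0$; 3) the orbits contained in $\{x_n=0\}$ are the orbits of the coadjoint representation in $\mathcal V_{n-1}^*$, where the hyperplane $\{x_n=0\}\subset\mathcal V_n^*$ is identified with $\mathcal V_{n-1}^*$ via the coordinates $x_1,\dots,x_{n-1}$.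
   Context: The coordinate $x_i$ on $\mathcal V_n^*$ is the linear function given by $e_i\in\mathcal V_n$. The orbits are those of the coadjoint action of the simply connected nilpotent Lie group $V_n$ with Lie algebra $\mathcal V_n$. Definition of $F_{2q+2}$ ($n=2q+2$, $q\ge1$): $F=F_{2q+2}$ is a polynomial in $x_{q+1},\dots,x_{2q+2}$ only (so $\partial F/\partial x_1=\dots=\partial F/\partial x_q=0$), with zero constant term, whose partial derivatives $\partial F/\partial x_{q+1},\dots,\partial F/\partial x_{2q+1}$ are the unique solution (for $x_{2q+2}\neq0$) of the linear system $$\frac{\partial F}{\partial x_{q+1}}=x_{2q+2}^{\,q},\qquad \sum_{k=q+1}^{2q+2-i}(k-i)\,x_{i+k}\,\frac{\partial F}{\partial x_k}=0,\quad i=1,\dots,q .$$ Equivalently, for $m=0,\dots,q-1$, $$\frac{\partial F}{\partial x_{q+m+2}}=-\frac{1}{(2m+2)x_{2q+2}}\sum_{l=1}^{m+1}(l+m)\,x_{2q+l-m}\,\frac{\partial F}{\partial x_{q+l}} .$$ These expressions are polynomials in $x_{q+1},\dots,x_{2q+2}$, and such an $F$ exists; it is determined up to adding a polynomial in $x_{2q+2}$ alone without constant term, and any choice may be taken. For example $F_4=x_2x_4-\frac14x_3^2$ and $F_6=x_3x_6^2-\frac12x_4x_5x_6+\frac18x_5^3$. *)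

theory Defs
  imports "HOL-Analysis.Analysis"
begin

text \<open>
  Vectors with \<open>n\<close> coordinates, indexed by \<open>1, \<dots>, n\<close>, are functions \<open>nat \<Rightarrow> real\<close> that vanish
  off \<open>{1..n}\<close>. An element of \<open>Vn n\<close> is given by its coordinates in the basis
  \<open>e\<^sub>1, \<dots>, e\<^sub>n\<close>; an element \<open>\<xi>\<close> of the dual space \<open>Vn_dual n\<close> is given by the values
  \<open>\<xi> i = x\<^sub>i(\<xi>) = \<langle>\<xi>, e\<^sub>i\<rangle>\<close>. With this encoding the set of all \<open>\<xi>\<close> in \<open>Vn_dual n\<close> with \<open>\<xi> n = 0\<close> is
  literally \<open>Vn_dual (n - 1)\<close>, and the identification via \<open>x\<^sub>1, \<dots>, x\<^bsub>n-1\<^esub>\<close> is the identity map.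
\<close>

definition Vn :: "nat \<Rightarrow> (nat \<Rightarrow> real) set" where
  "Vn n = {v. \<forall>i. i \<notin> {1..n} \<longrightarrow> v i = 0}"

definition Vn_dual :: "nat \<Rightarrow> (nat \<Rightarrow> real) set" where
  "Vn_dual n = {\<xi>. \<forall>i. i \<notin> {1..n} \<longrightarrow> \<xi> i = 0}"

definition bas :: "nat \<Rightarrow> nat \<Rightarrow> real" where
  "bas i = (\<lambda>k. if k = i then 1 else 0)"

definition pairing :: "nat \<Rightarrow> (nat \<Rightarrow> real) \<Rightarrow> (nat \<Rightarrow> real) \<Rightarrow> real" where
  "pairing n \<xi> v = (\<Sum>i\<in>{1..n}. \<xi> i * v i)"

definition bracket :: "nat \<Rightarrow> (nat \<Rightarrow> real) \<Rightarrow> (nat \<Rightarrow> real) \<Rightarrow> nat \<Rightarrow> real" where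
  "bracket n u v = (\<lambda>k. \<Sum>i\<in>{1..n}. \<Sum>j\<in>{1..n}.
     u i * v j * (if i + j \<le> n then (real j - real i) * bas (i + j) k else 0))"

text \<open>The coadjoint representation of the Lie algebra, \<open>\<langle>ad\<^sup>*\<^sub>v \<xi>, w\<rangle> = - \<langle>\<xi>, [v, w]\<rangle>\<close>.\<close>

definition ad_star :: "nat \<Rightarrow> (nat \<Rightarrow> real) \<Rightarrow> (nat \<Rightarrow> real) \<Rightarrow> nat \<Rightarrow> real" where
  "ad_star n v \<xi> = (\<lambda>k. if k \<in> {1..n} then - pairing n \<xi> (bracket n v (bas k)) else 0)"

definition lin_exp :: "((nat \<Rightarrow> real) \<Rightarrow> nat \<Rightarrow> real) \<Rightarrow> (nat \<Rightarrow> real) \<Rightarrow> nat \<Rightarrow> real" where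
  "lin_exp A \<xi> = (\<lambda>k. \<Sum>m. (A ^^ m) \<xi> k / fact m)"

text \<open>
  The image of the simply connected Lie group with Lie algebra \<open>Vn n\<close> under its coadjoint
  representation \<open>Ad\<^sup>*\<close>. A connected Lie group is generated by the exponentials \<open>exp v\<close> of the
  elements \<open>v\<close> of its Lie algebra, and \<open>Ad\<^sup>*(exp v) = exp (ad\<^sup>*\<^sub>v)\<close>; hence this image is the group
  generated by the operators \<open>exp (ad\<^sup>*\<^sub>v)\<close>. Inverses need no extra clause, since
  \<open>exp (ad\<^sup>*\<^sub>v)\<close> and \<open>exp (ad\<^sup>*\<^bsub>-v\<^esub>)\<close> are inverse to each other.
\<close>

inductive_set coadjoint_group :: "nat \<Rightarrow> ((nat \<Rightarrow> real) \<Rightarrow> nat \<Rightarrow> real) set" for n :: nat where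
  id_in: "id \<in> coadjoint_group n"
| exp_in: "v \<in> Vn n \<Longrightarrow> g \<in> coadjoint_group n \<Longrightarrow> lin_exp (ad_star n v) \<circ> g \<in> coadjoint_group n"

definition coadjoint_orbit :: "nat \<Rightarrow> (nat \<Rightarrow> real) \<Rightarrow> (nat \<Rightarrow> real) set" where
  "coadjoint_orbit n \<xi> = (\<lambda>g. g \<xi>) ` coadjoint_group n"

definition coadjoint_orbits :: "nat \<Rightarrow> (nat \<Rightarrow> real) set set" where
  "coadjoint_orbits n = coadjoint_orbit n ` Vn_dual n"

text \<open>
  Real polynomials in the coordinates \<open>x\<^sub>i\<close>, \<open>i \<in> I\<close>, as polynomial functions (over an infinite
  field the two notions coincide), built in the style of \<open>real_polynomial_function\<close>, which is not
  available on \<open>nat \<Rightarrow> real\<close>. The constant term is the value at \<open>0\<close>.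
\<close>

inductive polynomial_in :: "nat set \<Rightarrow> ((nat \<Rightarrow> real) \<Rightarrow> real) \<Rightarrow> bool" for I :: "nat set" where
  const: "polynomial_in I (\<lambda>x. c)"
| coord: "i \<in> I \<Longrightarrow> polynomial_in I (\<lambda>x. x i)"
| add: "polynomial_in I f \<Longrightarrow> polynomial_in I g \<Longrightarrow> polynomial_in I (\<lambda>x. f x + g x)"
| mult: "polynomial_in I f \<Longrightarrow> polynomial_in I g \<Longrightarrow> polynomial_in I (\<lambda>x. f x * g x)"

definition partial_deriv :: "nat \<Rightarrow> ((nat \<Rightarrow> real) \<Rightarrow> real) \<Rightarrow> (nat \<Rightarrow> real) \<Rightarrow> real" where
  "partial_deriv k F x = deriv (\<lambda>t. F (x(k := t))) (x k)"

text \<open>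
  \<open>is_F q F\<close>: \<open>F\<close> is a possible choice of the polynomial \<open>F\<^bsub>2q+2\<^esub>\<close>, which is determined only up to
  adding a polynomial in \<open>x\<^bsub>2q+2\<^esub>\<close> without constant term.
\<close>

definition is_F :: "nat \<Rightarrow> ((nat \<Rightarrow> real) \<Rightarrow> real) \<Rightarrow> bool" where
  "is_F q F \<longleftrightarrow>
     polynomial_in {q+1..2*q+2} F \<and> F (\<lambda>_. 0) = 0 \<and>
     (\<forall>x\<in>Vn_dual (2*q+2). x (2*q+2) \<noteq> 0 \<longrightarrow>
        partial_deriv (q+1) F x = x (2*q+2) ^ q \<and>
        (\<forall>i\<in>{1..q}. (\<Sum>k\<in>{q+1..2*q+2-i}.
            (real k - real i) * x (i + k) * partial_deriv k F x) = 0))"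

lemma bracket_bas:
  assumes "i \<in> {1..n}" "j \<in> {1..n}"
  shows "bracket n (bas i) (bas j) =
    (if i + j \<le> n then (\<lambda>k. (real j - real i) * bas (i + j) k) else (\<lambda>k. 0))"
proof
  fix k
  have pick: "(\<Sum>a\<in>{1..n}. bas i a * f a) = f i" if "i \<in> {1..n}" for i :: nat and f :: "nat \<Rightarrow> real"
    using that by (simp add: bas_def if_distrib[of "\<lambda>y. y * _"] cong: if_cong)
  show "bracket n (bas i) (bas j) k =
      (if i + j \<le> n then (\<lambda>k. (real j - real i) * bas (i + j) k) else (\<lambda>k. 0)) k"
    using assms unfolding bracket_def mult.assoc sum_distrib_left[symmetric] by (simp only: pick) simp
qed

text \<open>The operators \<open>ad\<^sup>*\<^sub>v\<close> are nilpotent, so that the series defining \<open>exp (ad\<^sup>*\<^sub>v)\<close> is a finite sum.\<close>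

lemma ad_star_nilpotent:
  assumes "\<xi> \<in> Vn_dual n" "n < k + m"
  shows "(ad_star n v ^^ m) \<xi> k = 0"
  using assms(2)
proof (induction m arbitrary: k)
  case 0
  then show ?case using assms(1) by (simp add: Vn_dual_def)
next
  case (Suc m)
  have "(ad_star n v ^^ m) \<xi> i * bracket n v (bas k) i = 0" if "i \<in> {1..n}" for i
  proof (cases "k < i")
    case True
    with Suc show ?thesis by simp
  next
    case False
    then have "bracket n v (bas k) i = 0"
      unfolding bracket_def by (intro sum.neutral ballI) (auto simp: bas_def)
    then show ?thesis by simp
  qed
  then have "pairing n ((ad_star n v ^^ m) \<xi>) (bracket n v (bas k)) = 0"
    unfolding pairing_def by (intro sum.neutral) blast
  then show ?case by (simp only: funpow.simps o_apply ad_star_def[of n v "(ad_star n v ^^ m) \<xi>"]) simp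
qed

lemma lin_exp_ad_star:
  assumes "\<xi> \<in> Vn_dual n"
  shows "lin_exp (ad_star n v) \<xi> k = (\<Sum>m\<le>n. (ad_star n v ^^ m) \<xi> k / fact m)"
  unfolding lin_exp_def
  by (rule suminf_finite) (auto simp: ad_star_nilpotent[OF assms])

end

theory Submission
  imports Defs
begin

text \<open>
  Write \<open>c = x\<^sub>n(\<xi>)\<close>; this number is constant on every orbit, because \<open>e\<^sub>n\<close> is central.

  \<^emph>\<open>Large orbits.\<close> The one-parameter group of \<open>e\<^bsub>n-k\<^esub>\<close> fixes the coordinates \<open>x\<^sub>j\<close>, \<open>j > k\<close>, and
  translates \<open>x\<^sub>k\<close> by a multiple of \<open>(n - 2k) c\<close>. So if \<open>c \<noteq> 0\<close>, then going down from \<open>k = n - 1\<close> to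
  \<open>k = 1\<close> one can prescribe all the coordinates of a point of the orbit other than \<open>x\<^bsub>n/2\<^esub>\<close>
  (\<open>orbit_matches_coordinates\<close>). For odd \<open>n\<close> nothing is left over and the orbit is the whole
  hyperplane. For \<open>n = 2q+2\<close> the coordinate \<open>x\<^bsub>q+1\<^esub>\<close> is left over, and it is determined by the value of
  \<open>F\<close>: first, \<open>F\<close> is constant on the orbit, since the linear system that defines it says precisely
  that all the vector fields \<open>\<xi> \<mapsto> ad\<^sup>*\<^sub>v \<xi>\<close> annihilate \<open>F\<close> (\<open>is_F_orbit\<close>); secondly, \<open>F\<close> is affine in
  \<open>x\<^bsub>q+1\<^esub>\<close> with slope \<open>c\<^sup>q \<noteq> 0\<close> (\<open>is_F_affine\<close>). Hence orbits are level sets (\<open>coadjoint_orbit_even\<close>).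

  \<^emph>\<open>Existence of \<open>F\<close>.\<close> A covector with coordinates \<open>x\<^sub>i\<close> is a quadratic differential
  \<open>\<Sum>\<^sub>i x\<^sub>i z\<^bsup>-i-2\<^esup> dz\<^sup>2\<close>, and the group acts by changes of the variable \<open>z\<close>. For \<open>n = 2q+2\<close> the residue
  of its square root is invariant. With \<open>y\<^sub>j = x\<^bsub>n-j\<^esub>\<close> this residue is the coefficient of \<open>z\<^bsup>q+1\<^esup>\<close> in
  \<open>(y\<^sub>0 + y\<^sub>1 z + \<dots>)\<^bsup>1/2\<^esup>\<close>. The substitution of \<open>y\<^sub>0 z\<close> for \<open>z\<close> clears the denominators: the series
  \<open>T(z)\<close> with \<open>T\<^sup>2 = 1 + \<Sum>\<^bsub>m>0\<^esub> y\<^sub>0\<^bsup>m-1\<^esup> y\<^sub>m z\<^sup>m\<close> has polynomial coefficients, and \<open>F = 2 [z\<^bsup>q+1\<^esup>] T\<close> is a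
  solution (\<open>is_F_sqrt_coeff\<close>).

  \<^emph>\<open>The wall \<open>x\<^sub>n = 0\<close>.\<close> There the recursion for the coefficients of \<open>T\<close> involves \<open>y\<^sub>1\<close> alone, which
  gives \<open>const \<cdot> x\<^bsub>n-1\<^esub>\<^bsup>q+1\<^esup>\<close> for this choice of \<open>F\<close>, and all choices agree on the wall
  (\<open>is_F_unique_on_wall\<close>). Finally, on the wall \<open>e\<^sub>n\<close> acts trivially and the other \<open>e\<^sub>i\<close> act as in
  dimension \<open>n - 1\<close>, so the orbits are the same sets (\<open>coadjoint_orbit_pred\<close>).
\<close>

section \<open>The coadjoint action in coordinates\<close>

lemma ad_star_coord:
  assumes "1 \<le> k" "k \<le> n"
  shows "ad_star n v \<xi> k = - (\<Sum>i\<in>{1..n-k}. (real k - real i) * v i * \<xi> (i + k))"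
proof -
  have b: "bracket n v (bas k) s =
      (\<Sum>i\<in>{1..n}. if i + k \<le> n then v i * ((real k - real i) * bas (i + k) s) else 0)" for s
  proof -
    have "(\<Sum>j\<in>{1..n}. v i * bas k j * (if i + j \<le> n then (real j - real i) * bas (i + j) s else 0))
        = (if i + k \<le> n then v i * ((real k - real i) * bas (i + k) s) else 0)" for i
    proof -
      have "(\<Sum>j\<in>{1..n}. v i * bas k j * (if i + j \<le> n then (real j - real i) * bas (i + j) s else 0))
        = (\<Sum>j\<in>{1..n}. if j = k then v i * (if i + k \<le> n then (real k - real i) * bas (i + k) s else 0) else 0)"
        by (intro sum.cong) (auto simp: bas_def)
      also have "\<dots> = v i * (if i + k \<le> n then (real k - real i) * bas (i + k) s else 0)"
        using assms by simp
      finally show ?thesis by simp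
    qed
    then show ?thesis unfolding bracket_def by simp
  qed
  have "pairing n \<xi> (bracket n v (bas k)) =
      (\<Sum>i\<in>{1..n}. \<Sum>s\<in>{1..n}. \<xi> s * (if i + k \<le> n then v i * ((real k - real i) * bas (i + k) s) else 0))"
    unfolding pairing_def b sum_distrib_left by (rule sum.swap)
  also have "\<dots> = (\<Sum>i\<in>{1..n}. if i \<le> n - k then (real k - real i) * v i * \<xi> (i + k) else 0)"
  proof (intro sum.cong refl)
    fix i assume i: "i \<in> {1..n}"
    show "(\<Sum>s\<in>{1..n}. \<xi> s * (if i + k \<le> n then v i * ((real k - real i) * bas (i + k) s) else 0))
      = (if i \<le> n - k then (real k - real i) * v i * \<xi> (i + k) else 0)"
    proof (cases "i + k \<le> n")
      case True
      have "(\<Sum>s\<in>{1..n}. \<xi> s * (if i + k \<le> n then v i * ((real k - real i) * bas (i + k) s) else 0))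
         = (\<Sum>s\<in>{1..n}. if s = i + k then (real k - real i) * v i * \<xi> (i + k) else 0)"
        using True by (intro sum.cong) (auto simp: bas_def)
      also have "\<dots> = (real k - real i) * v i * \<xi> (i + k)" using True i by simp
      finally have "(\<Sum>s\<in>{1..n}. \<xi> s * (if i + k \<le> n then v i * ((real k - real i) * bas (i + k) s) else 0))
        = (real k - real i) * v i * \<xi> (i + k)" .
      moreover have "i \<le> n - k" using True by simp
      ultimately show ?thesis by (simp only: if_True)
    next
      case False
      then have "\<not> i \<le> n - k" using assms by arith
      then show ?thesis using False by simp
    qed
  qed
  also have "\<dots> = (\<Sum>i\<in>{1..n-k}. (real k - real i) * v i * \<xi> (i + k))"
    by (intro sum.mono_neutral_cong_right) auto
  finally show ?thesis using assms by (simp add: ad_star_def)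
qed

lemma ad_star_outside: "k \<notin> {1..n} \<Longrightarrow> ad_star n v \<xi> k = 0"
  by (simp only: ad_star_def if_False)

lemma ad_star_top: "ad_star n v \<xi> n = 0"
  by (cases "n = 0") (simp_all add: ad_star_outside ad_star_coord)

lemma lin_exp_fixed:
  assumes "\<xi> \<in> Vn_dual n" "\<And>\<eta>. ad_star n v \<eta> k = 0"
  shows "lin_exp (ad_star n v) \<xi> k = \<xi> k"
proof -
  have "(\<Sum>m\<le>n. (ad_star n v ^^ m) \<xi> k / fact m) = (\<Sum>m\<le>n. if m = 0 then \<xi> k else 0)"
    by (intro sum.cong refl) (auto simp: assms(2) gr0_conv_Suc)
  then show ?thesis by (simp add: lin_exp_ad_star[OF assms(1)])
qed

lemma lin_exp_closed:
  assumes "\<xi> \<in> Vn_dual n"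
  shows "lin_exp (ad_star n v) \<xi> \<in> Vn_dual n"
  using assms lin_exp_fixed[OF assms ad_star_outside] unfolding Vn_dual_def by auto

lemma lin_exp_top:
  "\<xi> \<in> Vn_dual n \<Longrightarrow> lin_exp (ad_star n v) \<xi> n = \<xi> n"
  by (rule lin_exp_fixed[OF _ ad_star_top])

section \<open>Orbits\<close>

lemma coadjoint_orbit_refl: "\<xi> \<in> coadjoint_orbit n \<xi>"
  unfolding coadjoint_orbit_def by (rule image_eqI[OF _ coadjoint_group.id_in]) simp

lemma coadjoint_orbit_step:
  "\<eta> \<in> coadjoint_orbit n \<xi> \<Longrightarrow> v \<in> Vn n \<Longrightarrow> lin_exp (ad_star n v) \<eta> \<in> coadjoint_orbit n \<xi>"
  unfolding coadjoint_orbit_def by (auto intro!: image_eqI[OF _ coadjoint_group.exp_in])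

text \<open>
  The group is generated by exponentials under left composition, so a property of the points of an
  orbit can be proved along a chain of exponentials starting at \<open>\<xi>\<close>. This replaces all reasoning
  about group elements below.
\<close>

lemma coadjoint_orbit_induct [consumes 1, case_names refl step]:
  assumes "\<eta> \<in> coadjoint_orbit n \<xi>" "P \<xi>"
    and "\<And>\<eta> v. \<lbrakk>\<eta> \<in> coadjoint_orbit n \<xi>; P \<eta>; v \<in> Vn n\<rbrakk> \<Longrightarrow> P (lin_exp (ad_star n v) \<eta>)"
  shows "P \<eta>"
proof -
  have "P (g \<xi>)" if "g \<in> coadjoint_group n" for g
    using that
  proof induction
    case id_in
    then show ?case using assms(2) by simp
  next
    case (exp_in v g)
    then show ?case using assms(3)[of "g \<xi>" v] by (auto simp: coadjoint_orbit_def)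
  qed
  then show ?thesis using assms(1) by (auto simp: coadjoint_orbit_def)
qed

lemma coadjoint_orbit_invariants:
  assumes "\<eta> \<in> coadjoint_orbit n \<xi>" "\<xi> \<in> Vn_dual n"
  shows "\<eta> \<in> Vn_dual n \<and> \<eta> n = \<xi> n"
  using assms(1) by (induction rule: coadjoint_orbit_induct) (simp_all add: assms lin_exp_closed lin_exp_top)

section \<open>Transitivity away from the wall\<close>

text \<open>
  With \<open>v = t e\<^bsub>n-k\<^esub>\<close>, the \<open>j\<close>-th coordinate of \<open>ad\<^sup>*\<^sub>v \<eta>\<close> is a multiple of \<open>\<eta>\<^bsub>n-k+j\<^esub>\<close>, hence zero for
  \<open>j > k\<close>; for \<open>j = k\<close> it is a multiple of \<open>\<eta>\<^sub>n\<close>. As \<open>ad\<^sup>*\<^sub>v \<eta>\<close> itself has vanishing \<open>n\<close>-th coordinate, the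
  exponential series at \<open>k\<close> stops after its linear term.
\<close>

lemma lin_exp_basis_shift:
  fixes t :: real
  assumes \<xi>: "\<xi> \<in> Vn_dual n" and k: "1 \<le> k" "k < n"
  defines "v \<equiv> \<lambda>i. t * bas (n - k) i"
  shows "v \<in> Vn n"
    and "k < j \<Longrightarrow> lin_exp (ad_star n v) \<xi> j = \<xi> j"
    and "lin_exp (ad_star n v) \<xi> k = \<xi> k + t * (real n - 2 * real k) * \<xi> n"
proof -
  show "v \<in> Vn n" using k by (auto simp: v_def Vn_def bas_def)
  show "lin_exp (ad_star n v) \<xi> j = \<xi> j" if "k < j"
  proof (rule lin_exp_fixed[OF \<xi>])
    fix \<eta>
    show "ad_star n v \<eta> j = 0"
    proof (cases "j \<le> n")
      case True
      have "(\<Sum>i\<in>{1..n-j}. (real j - real i) * v i * \<eta> (i + j)) = 0"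
        using True that k by (intro sum.neutral) (auto simp: v_def bas_def)
      then show ?thesis using True that k by (simp add: ad_star_coord)
    qed (simp add: ad_star_outside)
  qed
  have A: "ad_star n v \<eta> k = t * (real n - 2 * real k) * \<eta> n" for \<eta>
  proof -
    have "(\<Sum>i\<in>{1..n-k}. (real k - real i) * v i * \<eta> (i + k)) =
        (\<Sum>i\<in>{1..n-k}. if i = n - k then - (t * (real n - 2 * real k) * \<eta> n) else 0)"
      using k by (intro sum.cong refl) (auto simp: v_def bas_def of_nat_diff algebra_simps)
    also have "\<dots> = - (t * (real n - 2 * real k) * \<eta> n)" using k by (subst sum.delta) auto
    finally show ?thesis using k by (simp add: ad_star_coord)
  qed
  have pow: "(ad_star n v ^^ m) \<xi> k / fact m = (if m = 0 then \<xi> k else 0)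
      + (if m = 1 then t * (real n - 2 * real k) * \<xi> n else 0)" for m
  proof (cases m)
    case (Suc m')
    then show ?thesis by (cases m') (simp_all add: A ad_star_top)
  qed simp
  show "lin_exp (ad_star n v) \<xi> k = \<xi> k + t * (real n - 2 * real k) * \<xi> n"
    using k unfolding lin_exp_ad_star[OF \<xi>] pow by (simp add: sum.distrib)
qed

text \<open>
  Adjusting the coordinates from the top down never disturbs those already adjusted. Only the
  coordinate \<open>x\<^bsub>n/2\<^esub>\<close>, for which the translation has length zero, escapes control.
\<close>

lemma orbit_matches_coordinates:
  assumes \<xi>: "\<xi> \<in> Vn_dual n" and \<eta>: "\<eta> \<in> Vn_dual n" and top: "\<xi> n = \<eta> n" "\<xi> n \<noteq> 0"
  shows "\<exists>\<zeta>\<in>coadjoint_orbit n \<xi>. \<forall>j. 2 * j \<noteq> n \<longrightarrow> \<zeta> j = \<eta> j"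
proof -
  have "\<exists>\<zeta>\<in>coadjoint_orbit n \<xi>. \<forall>j. k < j \<and> 2 * j \<noteq> n \<longrightarrow> \<zeta> j = \<eta> j" if "k \<le> n" for k
    using that
  proof (induction rule: inc_induct)
    case base
    have "\<forall>j>n. \<xi> j = \<eta> j" using \<xi> \<eta> by (auto simp: Vn_dual_def)
    then show ?case using coadjoint_orbit_refl by blast
  next
    case (step k)
    then obtain \<zeta> where \<zeta>: "\<zeta> \<in> coadjoint_orbit n \<xi>"
      and eq: "\<And>j. Suc k < j \<Longrightarrow> 2 * j \<noteq> n \<Longrightarrow> \<zeta> j = \<eta> j" by blast
    have \<zeta>V: "\<zeta> \<in> Vn_dual n" and \<zeta>n: "\<zeta> n = \<xi> n"
      using coadjoint_orbit_invariants[OF \<zeta> \<xi>] by auto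
    show ?case
    proof (cases "2 * Suc k = n \<or> Suc k = n")
      case True
      have "\<zeta> j = \<eta> j" if "k < j" "2 * j \<noteq> n" for j
        using that True eq[of j] \<zeta>n top by (cases "j = Suc k") auto
      then show ?thesis using \<zeta> by blast
    next
      case False
      with step have k: "1 \<le> Suc k" "Suc k < n" by auto
      define d where "d = (real n - 2 * real (Suc k)) * \<zeta> n"
      have "real n \<noteq> real (2 * Suc k)" using False by (metis of_nat_eq_iff)
      then have d: "d \<noteq> 0" using \<zeta>n top by (simp add: d_def)
      define v where "v = (\<lambda>i. (\<eta> (Suc k) - \<zeta> (Suc k)) / d * bas (n - Suc k) i)"
      note sh = lin_exp_basis_shift[OF \<zeta>V k, where t = "(\<eta> (Suc k) - \<zeta> (Suc k)) / d", folded v_def]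
      have "lin_exp (ad_star n v) \<zeta> (Suc k) = \<eta> (Suc k)"
        using sh(3) d unfolding mult.assoc d_def[symmetric] by simp
      moreover have "lin_exp (ad_star n v) \<zeta> j = \<eta> j" if "Suc k < j" "2 * j \<noteq> n" for j
        using sh(2)[OF that(1)] eq that by simp
      ultimately have "\<forall>j. k < j \<and> 2 * j \<noteq> n \<longrightarrow> lin_exp (ad_star n v) \<zeta> j = \<eta> j"
        by (metis Suc_lessI)
      then show ?thesis using coadjoint_orbit_step[OF \<zeta> sh(1)] by blast
    qed
  qed
  from this[of 0] obtain \<zeta> where \<zeta>: "\<zeta> \<in> coadjoint_orbit n \<xi>"
    and eq: "\<And>j. 0 < j \<Longrightarrow> 2 * j \<noteq> n \<Longrightarrow> \<zeta> j = \<eta> j" by blast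
  have "\<zeta> 0 = \<eta> 0"
    using coadjoint_orbit_invariants[OF \<zeta> \<xi>] \<eta> by (simp add: Vn_dual_def)
  then show ?thesis using \<zeta> eq by (metis gr0I)
qed

lemma coadjoint_orbit_odd:
  assumes \<xi>: "\<xi> \<in> Vn_dual n" and "odd n" "\<xi> n \<noteq> 0"
  shows "coadjoint_orbit n \<xi> = {\<eta> \<in> Vn_dual n. \<eta> n = \<xi> n}"
proof
  show "coadjoint_orbit n \<xi> \<subseteq> {\<eta> \<in> Vn_dual n. \<eta> n = \<xi> n}"
    using coadjoint_orbit_invariants[OF _ \<xi>] by auto
  show "{\<eta> \<in> Vn_dual n. \<eta> n = \<xi> n} \<subseteq> coadjoint_orbit n \<xi>"
  proof clarify
    fix \<eta> assume \<eta>: "\<eta> \<in> Vn_dual n" "\<eta> n = \<xi> n"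
    obtain \<zeta> where "\<zeta> \<in> coadjoint_orbit n \<xi>" "\<forall>j. 2 * j \<noteq> n \<longrightarrow> \<zeta> j = \<eta> j"
      using orbit_matches_coordinates[OF \<xi> \<eta>(1)] \<eta>(2) assms(3) by auto
    moreover have "2 * j \<noteq> n" for j using \<open>odd n\<close> by auto
    ultimately have "\<zeta> = \<eta>" by auto
    with \<open>\<zeta> \<in> coadjoint_orbit n \<xi>\<close> show "\<eta> \<in> coadjoint_orbit n \<xi>" by simp
  qed
qed

section \<open>Orbits on the wall\<close>

lemma Vn_dual_pred:
  assumes "1 \<le> n"
  shows "Vn_dual (n - 1) = {\<xi> \<in> Vn_dual n. \<xi> n = 0}"
proof -
  have "i \<notin> {1..n-1} \<longleftrightarrow> i \<notin> {1..n} \<or> i = n" for i using assms by auto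
  then show ?thesis unfolding Vn_dual_def by blast
qed

text \<open>
  If \<open>\<eta>\<^sub>n = 0\<close>, the structure constants with \<open>i + k = n\<close>, the only ones by which the brackets in dimensions
  \<open>n\<close> and \<open>n - 1\<close> differ, do not contribute to \<open>ad\<^sup>*\<^sub>v \<eta>\<close>.
\<close>

lemma lin_exp_ad_star_pred:
  assumes "1 \<le> n" "\<xi> \<in> Vn_dual (n - 1)" "\<And>i. i < n \<Longrightarrow> v i = w i"
  shows "lin_exp (ad_star n v) \<xi> = lin_exp (ad_star (n - 1) w) \<xi>"
proof -
  have step: "ad_star n v \<eta> = ad_star (n - 1) w \<eta>" if \<eta>: "\<eta> \<in> Vn_dual (n - 1)" for \<eta>
  proof
    fix k
    consider "k \<notin> {1..n}" | "k = n" | "1 \<le> k" "k \<le> n - 1" using assms(1) by fastforce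
    then show "ad_star n v \<eta> k = ad_star (n - 1) w \<eta> k"
    proof cases
      case 3
      have nk: "{1..n-k} = insert (n - k) {1..n-1-k}" "n - k \<notin> {1..n-1-k}" using 3 by auto
      have "\<eta> n = 0" using \<eta> assms(1) by (auto simp: Vn_dual_def)
      then have "(\<Sum>i\<in>{1..n-k}. (real k - real i) * v i * \<eta> (i + k)) =
          (\<Sum>i\<in>{1..n-1-k}. (real k - real i) * v i * \<eta> (i + k))"
        unfolding nk(1) using nk(2) 3 by simp
      also have "\<dots> = (\<Sum>i\<in>{1..n-1-k}. (real k - real i) * w i * \<eta> (i + k))"
        by (intro sum.cong refl) (auto simp: assms(3))
      finally have "(\<Sum>i\<in>{1..n-k}. (real k - real i) * v i * \<eta> (i + k)) =
          (\<Sum>i\<in>{1..n-1-k}. (real k - real i) * w i * \<eta> (i + k))" .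
      then show ?thesis using 3 by (simp add: ad_star_coord)
    next
      case 1
      then have "k \<notin> {1..n-1}" by auto
      then show ?thesis unfolding ad_star_outside[OF 1] by (rule ad_star_outside[symmetric])
    next
      case 2
      then show ?thesis using assms(1) by (simp add: ad_star_top ad_star_outside)
    qed
  qed
  have "(ad_star n v ^^ m) \<xi> = (ad_star (n - 1) w ^^ m) \<xi>
      \<and> (ad_star (n - 1) w ^^ m) \<xi> \<in> Vn_dual (n - 1)" for m
  proof (induction m)
    case (Suc m)
    then show ?case by (auto simp: step) (auto simp: Vn_dual_def ad_star_outside)
  qed (use assms in simp)
  then show ?thesis by (simp add: lin_exp_def)
qed

lemma coadjoint_orbit_pred:
  assumes n: "1 \<le> n" and \<xi>: "\<xi> \<in> Vn_dual (n - 1)"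
  shows "coadjoint_orbit n \<xi> = coadjoint_orbit (n - 1) \<xi>"
proof
  have V: "\<eta> \<in> Vn_dual (n - 1)" if "\<eta> \<in> coadjoint_orbit (n - 1) \<xi>" for \<eta>
    using coadjoint_orbit_invariants[OF that \<xi>] by simp
  show "coadjoint_orbit n \<xi> \<subseteq> coadjoint_orbit (n - 1) \<xi>"
  proof
    fix \<eta> assume "\<eta> \<in> coadjoint_orbit n \<xi>"
    then show "\<eta> \<in> coadjoint_orbit (n - 1) \<xi>"
    proof (induction rule: coadjoint_orbit_induct)
      case (step \<eta> v)
      have "v(n := 0) \<in> Vn (n - 1)" using step.hyps(2) by (auto simp: Vn_def)
      moreover have "lin_exp (ad_star n v) \<eta> = lin_exp (ad_star (n - 1) (v(n := 0))) \<eta>"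
        using n V[OF step.IH] by (intro lin_exp_ad_star_pred) auto
      ultimately show ?case using coadjoint_orbit_step[OF step.IH] by simp
    qed (rule coadjoint_orbit_refl)
  qed
  show "coadjoint_orbit (n - 1) \<xi> \<subseteq> coadjoint_orbit n \<xi>"
  proof
    fix \<eta> assume "\<eta> \<in> coadjoint_orbit (n - 1) \<xi>"
    then show "\<eta> \<in> coadjoint_orbit n \<xi>"
    proof (induction rule: coadjoint_orbit_induct)
      case (step \<eta> v)
      have "v \<in> Vn n" using step.hyps(2) by (auto simp: Vn_def)
      moreover have "lin_exp (ad_star n v) \<eta> = lin_exp (ad_star (n - 1) v) \<eta>"
        using n V[OF step.hyps(1)] by (intro lin_exp_ad_star_pred) auto
      ultimately show ?case using coadjoint_orbit_step[OF step.IH] by metis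
    qed (rule coadjoint_orbit_refl)
  qed
qed

section \<open>Calculus of polynomial functions\<close>

lemma polynomial_chain_rule:
  assumes "polynomial_in I f" "finite I"
    and "\<And>k. k \<in> I \<Longrightarrow> ((\<lambda>t. \<gamma> t k) has_real_derivative \<gamma>' k) (at t)"
  shows "((\<lambda>t. f (\<gamma> t)) has_real_derivative (\<Sum>k\<in>I. partial_deriv k f (\<gamma> t) * \<gamma>' k)) (at t)"
proof -
  (* The induction is run with an unspecified gradient g; the product case would otherwise need the
     differentiability of both factors separately. Paths parallel to the axes then identify g. *)
  have "\<exists>g. \<forall>\<gamma> \<gamma>' t. (\<forall>k\<in>I. ((\<lambda>t. \<gamma> t k) has_real_derivative \<gamma>' k) (at t)) \<longrightarrow>
      ((\<lambda>t. f (\<gamma> t)) has_real_derivative (\<Sum>k\<in>I. g k (\<gamma> t) * \<gamma>' k)) (at t)"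
    using assms(1)
  proof induction
    case (const c)
    show ?case by (rule exI[of _ "\<lambda>k x. 0"]) simp
  next
    case (coord i)
    have "(\<Sum>k\<in>I. (if k = i then 1 else 0) * \<gamma>' k) = \<gamma>' i" for \<gamma>' :: "nat \<Rightarrow> real"
      using coord assms(2) by (simp add: if_distrib[of "\<lambda>y. y * _"] cong: if_cong)
    then show ?case using coord by (intro exI[of _ "\<lambda>k x. if k = i then 1 else 0"]) simp
  next
    case (add f g)
    then obtain a b where
      a: "\<And>\<gamma> \<gamma>' t. (\<forall>k\<in>I. ((\<lambda>t. \<gamma> t k) has_real_derivative \<gamma>' k) (at t)) \<Longrightarrow>
        ((\<lambda>t. f (\<gamma> t)) has_real_derivative (\<Sum>k\<in>I. a k (\<gamma> t) * \<gamma>' k)) (at t)" and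
      b: "\<And>\<gamma> \<gamma>' t. (\<forall>k\<in>I. ((\<lambda>t. \<gamma> t k) has_real_derivative \<gamma>' k) (at t)) \<Longrightarrow>
        ((\<lambda>t. g (\<gamma> t)) has_real_derivative (\<Sum>k\<in>I. b k (\<gamma> t) * \<gamma>' k)) (at t)" by blast
    show ?case
    proof (intro exI[of _ "\<lambda>k x. a k x + b k x"] allI impI)
      fix \<gamma> \<gamma>' and t :: real
      assume h: "\<forall>k\<in>I. ((\<lambda>t. \<gamma> t k) has_real_derivative \<gamma>' k) (at t)"
      show "((\<lambda>t. f (\<gamma> t) + g (\<gamma> t)) has_real_derivative
          (\<Sum>k\<in>I. (a k (\<gamma> t) + b k (\<gamma> t)) * \<gamma>' k)) (at t)"
        using DERIV_add[OF a[OF h] b[OF h]] by (simp add: sum.distrib distrib_right)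
    qed
  next
    case (mult f g)
    then obtain a b where
      a: "\<And>\<gamma> \<gamma>' t. (\<forall>k\<in>I. ((\<lambda>t. \<gamma> t k) has_real_derivative \<gamma>' k) (at t)) \<Longrightarrow>
        ((\<lambda>t. f (\<gamma> t)) has_real_derivative (\<Sum>k\<in>I. a k (\<gamma> t) * \<gamma>' k)) (at t)" and
      b: "\<And>\<gamma> \<gamma>' t. (\<forall>k\<in>I. ((\<lambda>t. \<gamma> t k) has_real_derivative \<gamma>' k) (at t)) \<Longrightarrow>
        ((\<lambda>t. g (\<gamma> t)) has_real_derivative (\<Sum>k\<in>I. b k (\<gamma> t) * \<gamma>' k)) (at t)" by blast
    show ?case
    proof (intro exI[of _ "\<lambda>k x. a k x * g x + b k x * f x"] allI impI)
      fix \<gamma> \<gamma>' and t :: real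
      assume h: "\<forall>k\<in>I. ((\<lambda>t. \<gamma> t k) has_real_derivative \<gamma>' k) (at t)"
      show "((\<lambda>t. f (\<gamma> t) * g (\<gamma> t)) has_real_derivative
          (\<Sum>k\<in>I. (a k (\<gamma> t) * g (\<gamma> t) + b k (\<gamma> t) * f (\<gamma> t)) * \<gamma>' k)) (at t)"
        using DERIV_mult[OF a[OF h] b[OF h]]
        by (simp add: sum.distrib distrib_left sum_distrib_left mult_ac)
    qed
  qed
  then obtain g where g: "\<And>\<gamma> \<gamma>' t. (\<forall>k\<in>I. ((\<lambda>t. \<gamma> t k) has_real_derivative \<gamma>' k) (at t)) \<Longrightarrow>
      ((\<lambda>t. f (\<gamma> t)) has_real_derivative (\<Sum>k\<in>I. g k (\<gamma> t) * \<gamma>' k)) (at t)" by blast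
  have "partial_deriv j f x = g j x" if "j \<in> I" for j x
  proof -
    have "((\<lambda>t. f (x(j := t))) has_real_derivative
        (\<Sum>k\<in>I. g k (x(j := x j)) * (if k = j then 1 else 0))) (at (x j))"
      by (rule g) auto
    then have "((\<lambda>t. f (x(j := t))) has_real_derivative g j x) (at (x j))"
      using that assms(2) by (simp add: if_distrib cong: if_cong)
    then show ?thesis unfolding partial_deriv_def by (rule DERIV_imp_deriv)
  qed
  then show ?thesis using g[of \<gamma> \<gamma>' t] assms(3) by simp
qed

lemma polynomial_in_DERIV_coord:
  assumes "polynomial_in I f" "finite I" "j \<in> I"
  shows "((\<lambda>t. f (x(j := t))) has_real_derivative partial_deriv j f (x(j := t))) (at t)"
proof -
  have "((\<lambda>t. f (x(j := t))) has_real_derivative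
      (\<Sum>k\<in>I. partial_deriv k f (x(j := t)) * (if k = j then 1 else 0))) (at t)"
    by (rule polynomial_chain_rule[OF assms(1,2)]) auto
  then show ?thesis using assms(2,3) by (simp add: if_distrib cong: if_cong)
qed

section \<open>Invariance of F and the orbits in even dimension\<close>

lemma is_F_affine:
  assumes F: "is_F q F" and x: "x \<in> Vn_dual (2*q+2)" "x (2*q+2) \<noteq> 0"
  shows "F (x(q+1 := t)) = F x + x (2*q+2) ^ q * (t - x (q+1))"
proof -
  have p: "polynomial_in {q+1..2*q+2} F" using F by (simp add: is_F_def)
  have "((\<lambda>t. F (x(q+1 := t)) - x (2*q+2) ^ q * t) has_real_derivative 0) (at s)" for s
  proof -
    have "x(q+1 := s) \<in> Vn_dual (2*q+2)" using x(1) by (auto simp: Vn_dual_def)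
    then have "partial_deriv (q+1) F (x(q+1 := s)) = x (2*q+2) ^ q"
      using F x(2) unfolding is_F_def by fastforce
    then show ?thesis
      using polynomial_in_DERIV_coord[OF p, of "q+1" x s] by (auto intro!: derivative_eq_intros)
  qed
  then have "F (x(q+1 := t)) - x (2*q+2) ^ q * t = F (x(q+1 := x (q+1))) - x (2*q+2) ^ q * x (q+1)"
    using DERIV_isconst_all[where f = "\<lambda>t. F (x(q+1 := t)) - x (2*q+2) ^ q * t"] by blast
  then show ?thesis by (simp add: algebra_simps)
qed

text \<open>
  Collecting the coefficient of \<open>v\<^sub>i\<close> in \<open>\<Sum>\<^sub>k (\<partial>F/\<partial>x\<^sub>k) (ad\<^sup>*\<^sub>v x)\<^sub>k\<close> gives the left-hand side of the
  \<open>i\<close>-th defining equation of \<open>F\<close>. For \<open>i = q + 1\<close>, not among the defining equations, the only summand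
  is \<open>k = q + 1\<close>, and it carries the factor \<open>k - i = 0\<close>; for larger \<open>i\<close> there are no summands, since
  \<open>F\<close> involves only \<open>x\<^sub>k\<close> with \<open>k > q\<close>.
\<close>

lemma is_F_infinitesimally_invariant:
  assumes F: "is_F q F" and x: "x \<in> Vn_dual (2*q+2)" "x (2*q+2) \<noteq> 0"
  shows "(\<Sum>k\<in>{q+1..2*q+2}. partial_deriv k F x * ad_star (2*q+2) v x k) = 0"
proof -
  define h where "h k i = (real k - real i) * x (i + k) * partial_deriv k F x" for k i
  have "(\<Sum>k\<in>{q+1..2*q+2}. partial_deriv k F x * ad_star (2*q+2) v x k)
      = (\<Sum>k\<in>{q+1..2*q+2}. - (\<Sum>i\<in>{1..2*q+2-k}. v i * h k i))"
    by (intro sum.cong refl) (simp add: ad_star_coord h_def sum_distrib_left mult_ac)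
  also have "\<dots> = - (\<Sum>k\<in>{q+1..2*q+2}. \<Sum>i\<in>{i\<in>{1..q+1}. i + k \<le> 2*q+2}. v i * h k i)"
    unfolding sum_negf by (intro arg_cong[where f=uminus] sum.cong refl) auto
  also have "\<dots> = - (\<Sum>i\<in>{1..q+1}. \<Sum>k\<in>{k\<in>{q+1..2*q+2}. i + k \<le> 2*q+2}. v i * h k i)"
    by (subst sum.swap_restrict) auto
  also have "\<dots> = - (\<Sum>i\<in>{1..q+1}. v i * (\<Sum>k\<in>{q+1..2*q+2-i}. h k i))"
    unfolding sum_distrib_left by (intro arg_cong[where f=uminus] sum.cong refl) auto
  also have "\<dots> = 0"
  proof -
    have "(\<Sum>k\<in>{q+1..2*q+2-i}. h k i) = 0" if "i \<in> {1..q+1}" for i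
    proof (cases "i = q + 1")
      case True
      then have "{q+1..2*q+2-i} = {q+1}" by auto
      then show ?thesis using True by (simp add: h_def)
    next
      case False
      then show ?thesis using that F x unfolding is_F_def h_def by simp
    qed
    then show ?thesis by simp
  qed
  finally show ?thesis .
qed

lemma ad_star_sum:
  "ad_star n v (\<lambda>k. \<Sum>m\<in>M. c m * \<xi> m k) k = (\<Sum>m\<in>M. c m * ad_star n v (\<xi> m) k)"
proof (cases "k \<in> {1..n}")
  case True
  then show ?thesis
    by (simp add: ad_star_coord sum_distrib_left sum_negf mult_ac) (rule sum.swap)
qed (simp add: ad_star_outside)

text \<open>
  Along the curve \<open>\<gamma>(t) = exp(t ad\<^sup>*\<^sub>v) \<xi>\<close>, which solves \<open>\<gamma>' = ad\<^sup>*\<^sub>v \<gamma>\<close>, the derivative of \<open>F\<close> vanishes by the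
  chain rule and infinitesimal invariance.
\<close>

lemma is_F_lin_exp:
  assumes F: "is_F q F" and \<xi>: "\<xi> \<in> Vn_dual (2*q+2)" "\<xi> (2*q+2) \<noteq> 0"
  shows "F (lin_exp (ad_star (2*q+2) v) \<xi>) = F \<xi>"
proof -
  define n where "n = 2*q+2"
  define A where "A = ad_star n v"
  define \<gamma> where "\<gamma> t = (\<lambda>k. \<Sum>m\<le>n. t ^ m / fact m * (A ^^ m) \<xi> k)" for t :: real
  have fixed: "\<gamma> t k = \<xi> k" if "\<And>\<eta>. A \<eta> k = 0" for t k
  proof -
    have "\<gamma> t k = (\<Sum>m\<le>n. if m = 0 then \<xi> k else 0)"
      unfolding \<gamma>_def by (intro sum.cong refl) (auto simp: that gr0_conv_Suc)
    then show ?thesis by simp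
  qed
  have \<gamma>V: "\<gamma> t \<in> Vn_dual n" for t
    using \<xi>(1) fixed unfolding Vn_dual_def A_def n_def by (auto simp: ad_star_outside)
  have \<gamma>n: "\<gamma> t n = \<xi> n" for t using fixed ad_star_top unfolding A_def by blast
  have der: "((\<lambda>t. \<gamma> t k) has_real_derivative A (\<gamma> t) k) (at t)" for t k
  proof -
    have "((\<lambda>t. \<gamma> t k) has_real_derivative
        (\<Sum>m\<le>n. real m * t ^ (m - 1) / fact m * (A ^^ m) \<xi> k)) (at t)"
      unfolding \<gamma>_def by (auto intro!: derivative_eq_intros sum.cong)
    also have "(\<Sum>m\<le>n. real m * t ^ (m - 1) / fact m * (A ^^ m) \<xi> k)
        = (\<Sum>m<n. t ^ m / fact m * (A ^^ Suc m) \<xi> k)"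
    proof -
      have f: "real (Suc m) * t ^ (Suc m - 1) / fact (Suc m) = t ^ m / fact m" for m
        by (simp del: of_nat_Suc)
      have "(\<Sum>m\<le>n. real m * t ^ (m - 1) / fact m * (A ^^ m) \<xi> k)
          = (\<Sum>m<Suc n. real m * t ^ (m - 1) / fact m * (A ^^ m) \<xi> k)"
        by (simp only: lessThan_Suc_atMost)
      then show ?thesis unfolding sum.lessThan_Suc_shift f by simp
    qed
    also have "\<dots> = (\<Sum>m\<le>n. t ^ m / fact m * (A ^^ Suc m) \<xi> k)"
    proof -
      have "(A ^^ Suc n) \<xi> k = 0"
        unfolding A_def using \<xi>(1) by (intro ad_star_nilpotent) (auto simp: n_def)
      then show ?thesis by (simp add: lessThan_Suc_atMost[symmetric] del: funpow.simps)
    qed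
    also have "\<dots> = A (\<gamma> t) k" unfolding \<gamma>_def A_def ad_star_sum by simp
    finally show ?thesis .
  qed
  have p: "polynomial_in {q+1..n} F" using F by (simp add: is_F_def n_def)
  have "((\<lambda>t. F (\<gamma> t)) has_real_derivative 0) (at t)" for t
  proof -
    have "(\<Sum>k\<in>{q+1..n}. partial_deriv k F (\<gamma> t) * A (\<gamma> t) k) = 0"
      using is_F_infinitesimally_invariant[OF F, of "\<gamma> t" v] \<gamma>V \<gamma>n \<xi>(2) unfolding A_def n_def by simp
    moreover have "((\<lambda>t. F (\<gamma> t)) has_real_derivative
        (\<Sum>k\<in>{q+1..n}. partial_deriv k F (\<gamma> t) * A (\<gamma> t) k)) (at t)"
      by (rule polynomial_chain_rule[OF p _ der]) simp
    ultimately show ?thesis by simp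
  qed
  then have "F (\<gamma> 1) = F (\<gamma> 0)" using DERIV_isconst_all[where f = "\<lambda>t. F (\<gamma> t)"] by blast
  moreover have "\<gamma> 0 = \<xi>"
    by (rule ext) (simp add: \<gamma>_def power_0_left if_distrib[of "\<lambda>y. y / _"] if_distrib[of "\<lambda>y. y * _"] cong: if_cong)
  moreover have "\<gamma> 1 = lin_exp A \<xi>"
    using lin_exp_ad_star[of \<xi> n v] \<xi>(1) unfolding \<gamma>_def A_def n_def by (intro ext) simp
  ultimately show ?thesis by (simp add: A_def n_def)
qed

lemma is_F_orbit:
  assumes F: "is_F q F" and \<xi>: "\<xi> \<in> Vn_dual (2*q+2)" "\<xi> (2*q+2) \<noteq> 0"
    and "\<eta> \<in> coadjoint_orbit (2*q+2) \<xi>"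
  shows "F \<eta> = F \<xi>"
  using assms(4)
proof (induction rule: coadjoint_orbit_induct)
  case (step \<eta> v)
  then show ?case using is_F_lin_exp[OF F, of \<eta> v] coadjoint_orbit_invariants[OF step.hyps(1) \<xi>(1)] step.IH \<xi>(2) by simp
qed simp

text \<open>
  Two points of a level set agree, after moving one of them within its orbit, in all coordinates
  except \<open>x\<^bsub>q+1\<^esub>\<close>. The move preserves \<open>F\<close>, and \<open>F\<close> is injective in \<open>x\<^bsub>q+1\<^esub>\<close>, so they coincide.
\<close>

lemma coadjoint_orbit_even:
  assumes F: "is_F q F" and \<xi>: "\<xi> \<in> Vn_dual (2*q+2)" "\<xi> (2*q+2) \<noteq> 0"
  shows "coadjoint_orbit (2*q+2) \<xi> = {\<eta> \<in> Vn_dual (2*q+2). \<eta> (2*q+2) = \<xi> (2*q+2) \<and> F \<eta> = F \<xi>}"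
proof
  show "coadjoint_orbit (2*q+2) \<xi> \<subseteq> {\<eta> \<in> Vn_dual (2*q+2). \<eta> (2*q+2) = \<xi> (2*q+2) \<and> F \<eta> = F \<xi>}"
    using coadjoint_orbit_invariants[OF _ \<xi>(1)] is_F_orbit[OF F \<xi>] by auto
  show "{\<eta> \<in> Vn_dual (2*q+2). \<eta> (2*q+2) = \<xi> (2*q+2) \<and> F \<eta> = F \<xi>} \<subseteq> coadjoint_orbit (2*q+2) \<xi>"
  proof clarify
    fix \<eta> assume \<eta>: "\<eta> \<in> Vn_dual (2*q+2)" "\<eta> (2*q+2) = \<xi> (2*q+2)" "F \<eta> = F \<xi>"
    obtain \<zeta> where \<zeta>: "\<zeta> \<in> coadjoint_orbit (2*q+2) \<xi>" "\<forall>j. 2 * j \<noteq> 2*q+2 \<longrightarrow> \<zeta> j = \<eta> j"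
      using orbit_matches_coordinates[OF \<xi>(1) \<eta>(1)] \<eta>(2) \<xi>(2) by auto
    then have \<zeta>_eq: "\<zeta> = \<eta>(q+1 := \<zeta> (q+1))" by auto
    have "F \<zeta> = F \<eta>" using is_F_orbit[OF F \<xi> \<zeta>(1)] \<eta>(3) by simp
    then have "\<zeta> (q+1) = \<eta> (q+1)"
      using is_F_affine[OF F \<eta>(1), of "\<zeta> (q+1)"] \<eta>(2) \<xi>(2) \<zeta>_eq by simp
    then have "\<zeta> = \<eta>" using \<zeta>_eq by (metis fun_upd_triv)
    then show "\<eta> \<in> coadjoint_orbit (2*q+2) \<xi>" using \<zeta>(1) by simp
  qed
qed

lemma is_F_level_set_nonempty:
  assumes F: "is_F q F" and c1: "c1 \<noteq> 0"
  shows "\<exists>\<xi>\<in>Vn_dual (2*q+2). \<xi> (2*q+2) = c1 \<and> F \<xi> = c2"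
proof -
  define x where "x = (\<lambda>i. c1 * bas (2*q+2) i)"
  have x: "x \<in> Vn_dual (2*q+2)" "x (2*q+2) = c1" by (auto simp: x_def Vn_dual_def bas_def)
  define t where "t = x (q+1) + (c2 - F x) / c1 ^ q"
  have "F (x(q+1 := t)) = c2"
    using is_F_affine[OF F x(1), of t] x(2) c1 by (simp add: t_def)
  moreover have "x(q+1 := t) \<in> Vn_dual (2*q+2)" "(x(q+1 := t)) (2*q+2) = c1"
    using x by (auto simp: Vn_dual_def)
  ultimately show ?thesis by blast
qed

text \<open>
  The difference \<open>D\<close> of two choices is constant on orbits and independent of \<open>x\<^bsub>q+1\<^esub>\<close>, so by transitivity
  it depends on \<open>x\<^sub>n\<close> alone where \<open>x\<^sub>n \<noteq> 0\<close>. Being continuous, it takes on the whole wall its value at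
  the origin, which is zero.
\<close>

lemma is_F_unique_on_wall:
  assumes F: "is_F q F" and G: "is_F q G" and x: "x \<in> Vn_dual (2*q+2)" "x (2*q+2) = 0"
  shows "F x = G x"
proof -
  define n where "n = 2*q+2"
  define z :: "nat \<Rightarrow> real" where "z = (\<lambda>_. 0)"
  define D where "D \<eta> = F \<eta> - G \<eta>" for \<eta>
  have away: "D (x(n := t)) = D (z(n := t))" if t: "t \<noteq> 0" for t
  proof -
    have V: "x(n := t) \<in> Vn_dual (2*q+2)" "z(n := t) \<in> Vn_dual (2*q+2)"
      using x by (auto simp: Vn_dual_def z_def n_def)
    obtain \<zeta> where \<zeta>: "\<zeta> \<in> coadjoint_orbit (2*q+2) (x(n := t))"
      "\<forall>j. 2 * j \<noteq> 2*q+2 \<longrightarrow> \<zeta> j = (z(n := t)) j"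
      using orbit_matches_coordinates[OF V] t by (auto simp: n_def)
    then have \<zeta>_eq: "\<zeta> = (z(n := t))(q+1 := \<zeta> (q+1))" by auto
    have "D (x(n := t)) = D \<zeta>"
      using is_F_orbit[OF F V(1) _ \<zeta>(1)] is_F_orbit[OF G V(1) _ \<zeta>(1)] t by (simp add: D_def n_def)
    also have "\<dots> = D (z(n := t))"
      using is_F_affine[OF F V(2), of "\<zeta> (q+1)"] is_F_affine[OF G V(2), of "\<zeta> (q+1)"] t \<zeta>_eq
      by (simp add: D_def n_def)
    finally show ?thesis .
  qed
  have cont: "isCont (\<lambda>t. D (y(n := t))) 0" for y
  proof -
    have "isCont (\<lambda>t. H (y(n := t))) 0" if "is_F q H" for H
    proof -
      have "polynomial_in {q+1..2*q+2} H" using that by (simp add: is_F_def)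
      from polynomial_in_DERIV_coord[OF this, of n y 0] show ?thesis
        by (auto simp: n_def intro: DERIV_isCont)
    qed
    from this[OF F] this[OF G] show ?thesis unfolding D_def by (rule isCont_diff)
  qed
  have "((\<lambda>t. D (x(n := t))) \<longlongrightarrow> D (z(n := 0))) (at 0)"
  proof (rule Lim_transform_eventually)
    show "((\<lambda>t. D (z(n := t))) \<longlongrightarrow> D (z(n := 0))) (at 0)" using cont[of z] by (simp add: isCont_def)
    show "\<forall>\<^sub>F t in at 0. D (z(n := t)) = D (x(n := t))"
      using away by (auto simp: eventually_at_filter)
  qed
  moreover have "((\<lambda>t. D (x(n := t))) \<longlongrightarrow> D (x(n := 0))) (at 0)" using cont[of x] by (simp add: isCont_def)
  ultimately have "D (x(n := 0)) = D (z(n := 0))" by (rule LIM_unique[rotated])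
  moreover have "x(n := 0) = x" using x by (auto simp: n_def)
  moreover have "z(n := 0) = (\<lambda>_. 0)" by (auto simp: z_def)
  ultimately show ?thesis using F G by (simp add: D_def is_F_def)
qed

section \<open>The square root series\<close>

text \<open>
  \<open>sqrt_coeff y m\<close> is \<open>y\<^sub>0\<^sup>m\<close> times the coefficient of \<open>z\<^sup>m\<close> in \<open>(1 + \<Sum>\<^bsub>j>0\<^esub> (y\<^sub>j / y\<^sub>0) z\<^sup>j)\<^bsup>1/2\<^esup>\<close> when \<open>y\<^sub>0 \<noteq> 0\<close>. The
  recursion compares coefficients in the square; unlike the closed form it is free of denominators,
  so that it yields polynomials in the \<open>y\<^sub>j\<close>.
\<close>

fun sqrt_coeff :: "(nat \<Rightarrow> real) \<Rightarrow> nat \<Rightarrow> real" where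
  "sqrt_coeff y m = (if m = 0 then 1 else
     (y 0 ^ (m - 1) * y m - (\<Sum>l\<in>{1..<m}. sqrt_coeff y l * sqrt_coeff y (m - l))) / 2)"

declare sqrt_coeff.simps [simp del]

lemma sqrt_coeff_0: "sqrt_coeff y 0 = 1"
  by (simp add: sqrt_coeff.simps)

lemma sqrt_coeff_pos:
  "0 < m \<Longrightarrow> sqrt_coeff y m =
     (y 0 ^ (m - 1) * y m - (\<Sum>l\<in>{1..<m}. sqrt_coeff y l * sqrt_coeff y (m - l))) / 2"
  by (subst sqrt_coeff.simps) simp

lemma sum_split_ends:
  fixes f :: "nat \<Rightarrow> real"
  assumes "0 < m"
  shows "(\<Sum>l=0..m. f l) = f 0 + f m + (\<Sum>l\<in>{1..<m}. f l)"
proof -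
  have "{0..m} = insert 0 (insert m {1..<m})" using assms by auto
  then show ?thesis using assms by simp
qed

lemma polynomial_in_sum:
  assumes "finite A" "\<And>a. a \<in> A \<Longrightarrow> polynomial_in I (f a)"
  shows "polynomial_in I (\<lambda>x. \<Sum>a\<in>A. f a x)"
  using assms by (induction A) (auto intro: polynomial_in.intros)

lemma polynomial_in_power:
  "polynomial_in I f \<Longrightarrow> polynomial_in I (\<lambda>x. f x ^ m)"
  by (induction m) (auto intro: polynomial_in.intros)

lemma polynomial_in_sqrt_coeff:
  assumes "\<And>j. j \<le> m \<Longrightarrow> N - j \<in> I"
  shows "polynomial_in I (\<lambda>x. sqrt_coeff (\<lambda>j. x (N - j)) m)"
  using assms
proof (induction m rule: less_induct)
  case (less m)
  show ?case
  proof (cases "m = 0")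
    case True
    then show ?thesis by (simp add: sqrt_coeff_0 polynomial_in.const)
  next
    case False
    have "polynomial_in I (\<lambda>x. (x (N - 0) ^ (m - 1) * x (N - m) + (- 1) * (\<Sum>l\<in>{1..<m}.
        sqrt_coeff (\<lambda>j. x (N - j)) l * sqrt_coeff (\<lambda>j. x (N - j)) (m - l))) * (1 / 2))"
      using less.prems less.prems[of 0]
      by (intro polynomial_in.add polynomial_in.mult polynomial_in.const polynomial_in_sum
          polynomial_in_power polynomial_in.coord less.IH) auto
    then show ?thesis using False by (simp add: sqrt_coeff_pos[of m])
  qed
qed

text \<open>
  For \<open>y\<^sub>0 = 0\<close> the inhomogeneous term \<open>y\<^sub>0\<^bsup>m-1\<^esup> y\<^sub>m\<close> of the recursion survives only for \<open>m = 1\<close>, and the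
  convolution is homogeneous in the weight \<open>m\<close>.
\<close>

lemma sqrt_coeff_wall:
  "\<exists>c. \<forall>y. y 0 = 0 \<longrightarrow> sqrt_coeff y m = c * y 1 ^ m"
proof (induction m rule: less_induct)
  case (less m)
  then obtain c where c: "\<And>l y. l < m \<Longrightarrow> y 0 = 0 \<Longrightarrow> sqrt_coeff y l = c l * y 1 ^ l" by metis
  consider "m = 0" | "m = 1" | "m > 1" by linarith
  then show ?case
  proof cases
    case 1
    then show ?thesis by (intro exI[of _ 1]) (simp add: sqrt_coeff_0)
  next
    case 2
    then show ?thesis by (intro exI[of _ "1/2"]) (simp add: sqrt_coeff_pos)
  next
    case 3
    show ?thesis
    proof (intro exI[of _ "- (\<Sum>l\<in>{1..<m}. c l * c (m - l)) / 2"] allI impI)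
      fix y :: "nat \<Rightarrow> real" assume y: "y 0 = 0"
      have "(\<Sum>l\<in>{1..<m}. sqrt_coeff y l * sqrt_coeff y (m - l)) = (\<Sum>l\<in>{1..<m}. c l * c (m - l) * y 1 ^ m)"
      proof (intro sum.cong refl)
        fix l assume l: "l \<in> {1..<m}"
        then have "y 1 ^ l * y 1 ^ (m - l) = y 1 ^ m" by (simp flip: power_add)
        then show "sqrt_coeff y l * sqrt_coeff y (m - l) = c l * c (m - l) * y 1 ^ m"
          using l c[of l y] c[of "m - l" y] y by simp
      qed
      then have "(\<Sum>l\<in>{1..<m}. sqrt_coeff y l * sqrt_coeff y (m - l)) = (\<Sum>l\<in>{1..<m}. c l * c (m - l)) * y 1 ^ m"
        by (simp only: sum_distrib_right)
      then show "sqrt_coeff y m = - (\<Sum>l\<in>{1..<m}. c l * c (m - l)) / 2 * y 1 ^ m"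
        using 3 y by (simp add: sqrt_coeff_pos[of m] power_0_left)
    qed
  qed
qed

definition sqrt_fps :: "(nat \<Rightarrow> real) \<Rightarrow> real fps" where
  "sqrt_fps y = Abs_fps (sqrt_coeff y)"

lemma sqrt_fps_square:
  "sqrt_fps y * sqrt_fps y = Abs_fps (\<lambda>m. if m = 0 then 1 else y 0 ^ (m - 1) * y m)"
proof (rule fps_ext)
  fix m
  show "fps_nth (sqrt_fps y * sqrt_fps y) m = fps_nth (Abs_fps (\<lambda>m. if m = 0 then 1 else y 0 ^ (m - 1) * y m)) m"
  proof (cases "m = 0")
    case True
    then show ?thesis by (simp add: sqrt_fps_def sqrt_coeff_0)
  next
    case False
    then show ?thesis
      by (simp add: sqrt_fps_def fps_mult_nth sum_split_ends sqrt_coeff_0 sqrt_coeff_pos[of m])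
  qed
qed

lemma sqrt_fps_inverse: "sqrt_fps y * inverse (sqrt_fps y) = 1"
  by (rule inverse_mult_eq_1') (simp add: sqrt_fps_def sqrt_coeff_0)

text \<open>
  Differentiating \<open>T\<^sup>2 = 1 + \<Sum>\<^bsub>m>0\<^esub> y\<^sub>0\<^bsup>m-1\<^esup> y\<^sub>m z\<^sup>m\<close> by \<open>y\<^sub>j\<close> gives \<open>2 T \<partial>T/\<partial>y\<^sub>j = y\<^sub>0\<^bsup>j-1\<^esup> z\<^sup>j\<close>, that is,
  \<open>\<partial>T/\<partial>y\<^sub>j = y\<^sub>0\<^bsup>j-1\<^esup> z\<^sup>j / (2T)\<close>. The induction checks that the coefficients of this series \<open>D\<close> obey the
  differentiated recursion.
\<close>

lemma sqrt_coeff_deriv: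
  assumes "1 \<le> j"
  shows "((\<lambda>t. sqrt_coeff (y(j := t)) m) has_real_derivative
    (if j \<le> m then y 0 ^ (j - 1) * fps_nth (inverse (sqrt_fps y)) (m - j) / 2 else 0)) (at (y j))"
proof -
  define D where "D = fps_const (y 0 ^ (j - 1) / 2) * (inverse (sqrt_fps y) * fps_X ^ j)"
  have D_nth: "fps_nth D m = (if j \<le> m then y 0 ^ (j - 1) * fps_nth (inverse (sqrt_fps y)) (m - j) / 2 else 0)" for m
    by (simp add: D_def fps_X_power_mult_right_nth)
  have "D * sqrt_fps y = fps_const (y 0 ^ (j - 1) / 2) * fps_X ^ j * (sqrt_fps y * inverse (sqrt_fps y))"
    by (simp add: D_def mult_ac)
  then have DT: "D * sqrt_fps y = fps_const (y 0 ^ (j - 1) / 2) * fps_X ^ j"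
    by (simp add: sqrt_fps_inverse)
  have "((\<lambda>t. sqrt_coeff (y(j := t)) m) has_real_derivative fps_nth D m) (at (y j))"
  proof (induction m rule: less_induct)
    case (less m)
    show ?case
    proof (cases "m = 0")
      case True
      then show ?thesis using assms by (simp add: sqrt_coeff_0 D_nth)
    next
      case False
      have lin: "((\<lambda>t. y 0 ^ (m - 1) * (y(j := t)) m) has_real_derivative
          (if m = j then y 0 ^ (m - 1) else 0)) (at (y j))"
        by (auto intro!: derivative_eq_intros)
      have recur: "((\<lambda>t. (y 0 ^ (m - 1) * (y(j := t)) m
          - (\<Sum>l\<in>{1..<m}. sqrt_coeff (y(j := t)) l * sqrt_coeff (y(j := t)) (m - l))) / 2)
          has_real_derivative ((if m = j then y 0 ^ (m - 1) else 0)
          - (\<Sum>l\<in>{1..<m}. fps_nth D l * sqrt_coeff (y(j := y j)) (m - l)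
              + fps_nth D (m - l) * sqrt_coeff (y(j := y j)) l)) / 2) (at (y j))"
        by (intro DERIV_cdivide DERIV_diff lin DERIV_sum DERIV_mult less.IH) auto
      have "(\<Sum>l\<in>{1..<m}. fps_nth D (m - l) * sqrt_coeff y l)
          = (\<Sum>l\<in>{1..<m}. fps_nth D l * sqrt_coeff y (m - l))"
        by (rule sum.reindex_bij_witness[of _ "\<lambda>l. m - l" "\<lambda>l. m - l"]) auto
      moreover have "fps_nth (D * sqrt_fps y) m = (if m = j then y 0 ^ (m - 1) / 2 else 0)"
        unfolding DT by simp
      then have "fps_nth D m + (\<Sum>l\<in>{1..<m}. fps_nth D l * sqrt_coeff y (m - l))
          = (if m = j then y 0 ^ (m - 1) / 2 else 0)"
        using False assms
        by (simp add: fps_mult_nth sum_split_ends sqrt_fps_def sqrt_coeff_0 D_nth[of 0])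
      ultimately have "((if m = j then y 0 ^ (m - 1) else 0)
          - (\<Sum>l\<in>{1..<m}. fps_nth D l * sqrt_coeff (y(j := y j)) (m - l)
              + fps_nth D (m - l) * sqrt_coeff (y(j := y j)) l)) / 2 = fps_nth D m"
        by (simp add: sum.distrib field_simps split: if_splits)
      with recur have "((\<lambda>t. (y 0 ^ (m - 1) * (y(j := t)) m
          - (\<Sum>l\<in>{1..<m}. sqrt_coeff (y(j := t)) l * sqrt_coeff (y(j := t)) (m - l))) / 2)
          has_real_derivative fps_nth D m) (at (y j))"
        by (rule DERIV_cong)
      moreover have "(y(j := t)) 0 = y 0" for t using assms by simp
      ultimately show ?thesis using False by (simp only: sqrt_coeff_pos[of m] neq0_conv)
    qed
  qed
  then show ?thesis by (simp add: D_nth)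
qed

text \<open>
  With \<open>Q = T\<^sup>2\<close> the sum is the coefficient of \<open>z\<^sup>M\<close> in \<open>(2 M Q - z Q') T\<^sup>-\<^sup>1 = 2 (M T - z T')\<close>, and the
  operator \<open>z d/dz\<close> multiplies the coefficient of \<open>z\<^sup>M\<close> by \<open>M\<close>.
\<close>

lemma sqrt_fps_euler:
  "(\<Sum>l=0..M. (2 * real M - real l) * (if l = 0 then 1 else y 0 ^ (l - 1) * y l)
      * fps_nth (inverse (sqrt_fps y)) (M - l)) = 0"
proof -
  define T where "T = sqrt_fps y"
  define Q where "Q = T * T"
  have Qn: "fps_nth Q l = (if l = 0 then 1 else y 0 ^ (l - 1) * y l)" for l
    unfolding Q_def T_def sqrt_fps_square by simp
  have "Q * inverse T = T * (T * inverse T)" by (simp add: Q_def mult_ac)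
  then have QT: "Q * inverse T = T" by (simp add: T_def sqrt_fps_inverse)
  have "fps_deriv Q * inverse T = fps_deriv T * (T * inverse T) + fps_deriv T * (T * inverse T)"
    by (simp add: Q_def algebra_simps)
  then have QT': "fps_deriv Q * inverse T = fps_deriv T + fps_deriv T" by (simp add: T_def sqrt_fps_inverse)
  have "(\<Sum>l=0..M. (2 * real M - real l) * fps_nth Q l * fps_nth (inverse T) (M - l))
      = fps_nth ((fps_const (2 * real M) * Q - fps_X * fps_deriv Q) * inverse T) M"
    unfolding fps_mult_nth[of _ "inverse T"]
    by (intro sum.cong refl) (auto simp: algebra_simps gr0_conv_Suc)
  also have "(fps_const (2 * real M) * Q - fps_X * fps_deriv Q) * inverse T
      = fps_const (2 * real M) * T - fps_X * (fps_deriv T + fps_deriv T)"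
    by (simp only: left_diff_distrib mult.assoc QT QT')
  also have "fps_nth \<dots> M = 0"
  proof -
    have "fps_nth (fps_X * fps_deriv T) M = real M * fps_nth T M" by (cases M) simp_all
    then show ?thesis by (simp only: distrib_left fps_sub_nth fps_add_nth fps_mult_left_const_nth)
  qed
  finally show ?thesis unfolding Qn T_def .
qed

section \<open>Existence of F and its restriction to the wall\<close>

text \<open>
  By the derivative formula, \<open>\<partial>F/\<partial>x\<^sub>k\<close> is \<open>y\<^sub>0\<^bsup>j-1\<^esup>\<close> times the coefficient of \<open>z\<^bsup>q+1-j\<^esup>\<close> in \<open>T\<^sup>-\<^sup>1\<close>, where
  \<open>j = 2q+2-k\<close>. Putting \<open>l = j - i\<close> and \<open>M = q+1-i\<close>, the \<open>i\<close>-th equation becomes \<open>y\<^sub>0\<^sup>i\<close> times the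
  identity \<open>sqrt_fps_euler\<close>, because \<open>k - i = 2M - l\<close>.
\<close>

lemma is_F_sqrt_coeff:
  "is_F q (\<lambda>x. 2 * sqrt_coeff (\<lambda>j. x (2*q+2 - j)) (q+1))"
proof -
  define F where "F = (\<lambda>x. 2 * sqrt_coeff (\<lambda>j. x (2*q+2 - j)) (q+1))"
  have "polynomial_in {q+1..2*q+2} F"
    unfolding F_def
    by (intro polynomial_in.mult polynomial_in.const polynomial_in_sqrt_coeff) auto
  moreover have "F (\<lambda>_. 0) = 0"
  proof -
    obtain c where "\<forall>y. y 0 = 0 \<longrightarrow> sqrt_coeff y (q+1) = c * y 1 ^ (q+1)"
      using sqrt_coeff_wall by blast
    then show ?thesis by (simp add: F_def)
  qed
  moreover have "partial_deriv (q+1) F x = x (2*q+2) ^ q"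
    "\<forall>i\<in>{1..q}. (\<Sum>k\<in>{q+1..2*q+2-i}. (real k - real i) * x (i + k) * partial_deriv k F x) = 0" for x
  proof -
    define y where "y = (\<lambda>j. x (2*q+2 - j))"
    define R where "R = fps_nth (inverse (sqrt_fps y))"
    have pd: "partial_deriv k F x = y 0 ^ (2*q+1 - k) * R (k - (q+1))" if k: "k \<in> {q+1..2*q+1}" for k
    proof -
      have y_upd: "(\<lambda>j. (x(k := t)) (2*q+2 - j)) = y(2*q+2-k := t)" for t
        using k by (auto simp: y_def fun_eq_iff)
      have e: "q + 1 - (2*q+2-k) = k - (q+1)" "2*q+2-k - 1 = 2*q+1-k" "2*q+2-k \<le> q+1" "y (2*q+2-k) = x k"
        using k by (auto simp: y_def)
      have "((\<lambda>t. 2 * sqrt_coeff (y(2*q+2-k := t)) (q+1)) has_real_derivative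
          2 * (y 0 ^ (2*q+1-k) * R (k - (q+1)) / 2)) (at (x k))"
        using sqrt_coeff_deriv[of "2*q+2-k" y "q+1"] k e unfolding R_def
        by (intro DERIV_cmult) auto
      then show ?thesis unfolding partial_deriv_def F_def y_upd by (intro DERIV_imp_deriv) simp
    qed
    have R0: "R 0 = 1" by (simp add: R_def sqrt_fps_def sqrt_coeff_0)
    then show "partial_deriv (q+1) F x = x (2*q+2) ^ q" using pd[of "q+1"] by (simp add: y_def)
    show "\<forall>i\<in>{1..q}. (\<Sum>k\<in>{q+1..2*q+2-i}. (real k - real i) * x (i + k) * partial_deriv k F x) = 0"
    proof
      fix i assume i: "i \<in> {1..q}"
      define M where "M = q + 1 - i"
      have "(\<Sum>k\<in>{q+1..2*q+2-i}. (real k - real i) * x (i + k) * partial_deriv k F x)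
        = (\<Sum>l=0..M. y 0 ^ i * ((2 * real M - real l) * (if l = 0 then 1 else y 0 ^ (l - 1) * y l) * R (M - l)))"
      proof (rule sum.reindex_bij_witness[of _ "\<lambda>l. 2*q+2-i-l" "\<lambda>k. 2*q+2-i-k"])
        fix k assume k: "k \<in> {q+1..2*q+2-i}"
        have kr: "k \<in> {q+1..2*q+1}" using k i by auto
        define l where "l = 2*q+2-i-k"
        have e: "real k - real i = 2 * real M - real l" "x (i + k) = y l"
          "2*q+1-k = (i - 1) + l" "k - (q+1) = M - l"
          using k i by (auto simp: l_def M_def y_def of_nat_diff)
        have pw: "y 0 ^ i * (if l = 0 then 1 else y 0 ^ (l - 1) * y l) = y l * y 0 ^ ((i - 1) + l)"
          using i by (cases i; cases l) (simp_all add: power_add)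
        have "(real k - real i) * x (i + k) * partial_deriv k F x
            = (2 * real M - real l) * (y l * y 0 ^ ((i - 1) + l)) * R (M - l)"
          unfolding pd[OF kr] e by (simp only: mult_ac)
        then show "y 0 ^ i * ((2 * real M - real l) * (if l = 0 then 1 else y 0 ^ (l - 1) * y l) * R (M - l))
            = (real k - real i) * x (i + k) * partial_deriv k F x"
          unfolding pw[symmetric] by (simp add: mult_ac)
      qed (use i in \<open>auto simp: M_def\<close>)
      also have "\<dots> = 0" unfolding sum_distrib_left[symmetric] R_def sqrt_fps_euler by simp
      finally show "(\<Sum>k\<in>{q+1..2*q+2-i}. (real k - real i) * x (i + k) * partial_deriv k F x) = 0" .
    qed
  qed
  ultimately show ?thesis unfolding F_def[symmetric] is_F_def by blast
qed

lemma is_F_on_wall: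
  assumes "is_F q F"
  shows "\<exists>c. \<forall>\<xi>\<in>Vn_dual (2*q+2). \<xi> (2*q+2) = 0 \<longrightarrow> F \<xi> = c * \<xi> (2*q+1) ^ (q+1)"
proof -
  obtain c where c: "\<And>y. y 0 = 0 \<Longrightarrow> sqrt_coeff y (q+1) = c * y 1 ^ (q+1)"
    using sqrt_coeff_wall by blast
  have "F \<xi> = 2 * c * \<xi> (2*q+1) ^ (q+1)" if "\<xi> \<in> Vn_dual (2*q+2)" "\<xi> (2*q+2) = 0" for \<xi>
    using is_F_unique_on_wall[OF assms is_F_sqrt_coeff that] c[of "\<lambda>j. \<xi> (2*q+2 - j)"] that(2) by simp
  then show ?thesis by blast
qed

section \<open>Classification of the orbits\<close>

lemma orbit_subset_iff_top:
  assumes "\<xi> \<in> Vn_dual n"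
  shows "coadjoint_orbit n \<xi> \<subseteq> {\<eta>. P (\<eta> n)} \<longleftrightarrow> P (\<xi> n)"
proof
  assume "coadjoint_orbit n \<xi> \<subseteq> {\<eta>. P (\<eta> n)}"
  then show "P (\<xi> n)" using coadjoint_orbit_refl by blast
next
  assume P: "P (\<xi> n)"
  show "coadjoint_orbit n \<xi> \<subseteq> {\<eta>. P (\<eta> n)}"
  proof
    fix \<eta> assume "\<eta> \<in> coadjoint_orbit n \<xi>"
    from coadjoint_orbit_invariants[OF this assms] P show "\<eta> \<in> {\<eta>. P (\<eta> n)}" by simp
  qed
qed

lemma orbits_by_top:
  "{Orb \<in> coadjoint_orbits n. Orb \<subseteq> {\<xi>. P (\<xi> n)}} = coadjoint_orbit n ` {\<xi> \<in> Vn_dual n. P (\<xi> n)}"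
proof -
  have "{Orb \<in> coadjoint_orbits n. Orb \<subseteq> {\<xi>. P (\<xi> n)}}
      = coadjoint_orbit n ` {\<xi> \<in> Vn_dual n. coadjoint_orbit n \<xi> \<subseteq> {\<eta>. P (\<eta> n)}}"
    unfolding coadjoint_orbits_def by blast
  also have "{\<xi> \<in> Vn_dual n. coadjoint_orbit n \<xi> \<subseteq> {\<eta>. P (\<eta> n)}} = {\<xi> \<in> Vn_dual n. P (\<xi> n)}"
    using orbit_subset_iff_top by (intro Collect_cong conj_cong refl)
  finally show ?thesis .
qed

lemma orbits_in_wall:
  assumes "n \<ge> 1"
  shows "{Orb \<in> coadjoint_orbits n. Orb \<subseteq> {\<xi>. \<xi> n = 0}} = coadjoint_orbits (n - 1)"
proof -
  have "{Orb \<in> coadjoint_orbits n. Orb \<subseteq> {\<xi>. \<xi> n = 0}} = coadjoint_orbit n ` Vn_dual (n - 1)"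
    unfolding Vn_dual_pred[OF assms] by (rule orbits_by_top)
  also have "\<dots> = coadjoint_orbits (n - 1)"
    unfolding coadjoint_orbits_def using coadjoint_orbit_pred[OF assms] by (intro image_cong) auto
  finally show ?thesis .
qed

lemma even_orbits:
  assumes "is_F q F"
  shows "{Orb \<in> coadjoint_orbits (2*q+2). Orb \<subseteq> {\<xi>. \<xi> (2*q+2) \<noteq> 0}} =
     {{\<xi> \<in> Vn_dual (2*q+2). \<xi> (2*q+2) = c1 \<and> F \<xi> = c2} | c1 c2. c1 \<noteq> 0}"
  unfolding orbits_by_top[where P = "\<lambda>c. c \<noteq> 0"]
proof (intro set_eqI iffI)
  fix X assume "X \<in> coadjoint_orbit (2*q+2) ` {\<xi> \<in> Vn_dual (2*q+2). \<xi> (2*q+2) \<noteq> 0}"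
  then show "X \<in> {{\<xi> \<in> Vn_dual (2*q+2). \<xi> (2*q+2) = c1 \<and> F \<xi> = c2} | c1 c2. c1 \<noteq> 0}"
    using coadjoint_orbit_even[OF assms] by blast
next
  fix X assume "X \<in> {{\<xi> \<in> Vn_dual (2*q+2). \<xi> (2*q+2) = c1 \<and> F \<xi> = c2} | c1 c2. c1 \<noteq> 0}"
  then obtain c1 c2 where X: "X = {\<xi> \<in> Vn_dual (2*q+2). \<xi> (2*q+2) = c1 \<and> F \<xi> = c2}" "c1 \<noteq> 0" by blast
  obtain \<xi> where \<xi>: "\<xi> \<in> Vn_dual (2*q+2)" "\<xi> (2*q+2) = c1" "F \<xi> = c2"
    using is_F_level_set_nonempty[OF assms X(2)] by blast
  then have "X = coadjoint_orbit (2*q+2) \<xi>"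
    using coadjoint_orbit_even[OF assms \<xi>(1)] X by simp
  then show "X \<in> coadjoint_orbit (2*q+2) ` {\<xi> \<in> Vn_dual (2*q+2). \<xi> (2*q+2) \<noteq> 0}"
    using \<xi> X(2) by blast
qed

lemma odd_orbits:
  assumes "odd n"
  shows "{Orb \<in> coadjoint_orbits n. Orb \<subseteq> {\<xi>. \<xi> n \<noteq> 0}} = {{\<xi> \<in> Vn_dual n. \<xi> n = c} | c. c \<noteq> 0}"
  unfolding orbits_by_top[where P = "\<lambda>c. c \<noteq> 0"]
proof (intro set_eqI iffI)
  fix X assume "X \<in> coadjoint_orbit n ` {\<xi> \<in> Vn_dual n. \<xi> n \<noteq> 0}"
  then show "X \<in> {{\<xi> \<in> Vn_dual n. \<xi> n = c} | c. c \<noteq> 0}"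
    using coadjoint_orbit_odd[OF _ assms] by blast
next
  fix X assume "X \<in> {{\<xi> \<in> Vn_dual n. \<xi> n = c} | c. c \<noteq> 0}"
  then obtain c where X: "X = {\<xi> \<in> Vn_dual n. \<xi> n = c}" "c \<noteq> 0" by blast
  define \<xi> where "\<xi> = (\<lambda>i. c * bas n i)"
  have \<xi>: "\<xi> \<in> Vn_dual n" "\<xi> n = c" using odd_pos[OF assms] by (auto simp: \<xi>_def Vn_dual_def bas_def)
  then have "X = coadjoint_orbit n \<xi>" using coadjoint_orbit_odd[OF \<xi>(1) assms] X by simp
  then show "X \<in> coadjoint_orbit n ` {\<xi> \<in> Vn_dual n. \<xi> n \<noteq> 0}" using \<xi> X(2) by blast
qed

theorem theorem2:
  fixes n :: nat
  assumes "n \<ge> 2"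
  shows
    "(\<forall>q\<ge>1. n = 2*q+2 \<longrightarrow>
        (\<exists>F. is_F q F) \<and>
        (\<forall>F. is_F q F \<longrightarrow>
           {Orb \<in> coadjoint_orbits n. Orb \<subseteq> {\<xi>. \<xi> (2*q+2) \<noteq> 0}} =
             {{\<xi> \<in> Vn_dual n. \<xi> (2*q+2) = c1 \<and> F \<xi> = c2} | c1 c2. c1 \<noteq> 0} \<and>
           (\<exists>c. \<forall>\<xi>\<in>Vn_dual n. \<xi> (2*q+2) = 0 \<longrightarrow> F \<xi> = c * \<xi> (2*q+1) ^ (q+1)))) \<and>
     (\<forall>q\<ge>1. n = 2*q+1 \<longrightarrow>
        {Orb \<in> coadjoint_orbits n. Orb \<subseteq> {\<xi>. \<xi> (2*q+1) \<noteq> 0}} =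
          {{\<xi> \<in> Vn_dual n. \<xi> (2*q+1) = c} | c. c \<noteq> 0}) \<and>
     {Orb \<in> coadjoint_orbits n. Orb \<subseteq> {\<xi>. \<xi> n = 0}} = coadjoint_orbits (n - 1)"
proof (intro conjI)
  show "\<forall>q\<ge>1. n = 2*q+2 \<longrightarrow>
        (\<exists>F. is_F q F) \<and>
        (\<forall>F. is_F q F \<longrightarrow>
           {Orb \<in> coadjoint_orbits n. Orb \<subseteq> {\<xi>. \<xi> (2*q+2) \<noteq> 0}} =
             {{\<xi> \<in> Vn_dual n. \<xi> (2*q+2) = c1 \<and> F \<xi> = c2} | c1 c2. c1 \<noteq> 0} \<and>
           (\<exists>c. \<forall>\<xi>\<in>Vn_dual n. \<xi> (2*q+2) = 0 \<longrightarrow> F \<xi> = c * \<xi> (2*q+1) ^ (q+1)))"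
  proof (intro allI impI conjI)
    fix q assume q: "q \<ge> 1" "n = 2*q+2"
    show "\<exists>F. is_F q F" using is_F_sqrt_coeff by blast
    fix F assume F: "is_F q F"
    show "{Orb \<in> coadjoint_orbits n. Orb \<subseteq> {\<xi>. \<xi> (2*q+2) \<noteq> 0}} =
        {{\<xi> \<in> Vn_dual n. \<xi> (2*q+2) = c1 \<and> F \<xi> = c2} | c1 c2. c1 \<noteq> 0}"
      unfolding q(2) by (rule even_orbits[OF F])
    show "\<exists>c. \<forall>\<xi>\<in>Vn_dual n. \<xi> (2*q+2) = 0 \<longrightarrow> F \<xi> = c * \<xi> (2*q+1) ^ (q+1)"
      unfolding q(2) by (rule is_F_on_wall[OF F])
  qed
  show "\<forall>q\<ge>1. n = 2*q+1 \<longrightarrow>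
        {Orb \<in> coadjoint_orbits n. Orb \<subseteq> {\<xi>. \<xi> (2*q+1) \<noteq> 0}} =
          {{\<xi> \<in> Vn_dual n. \<xi> (2*q+1) = c} | c. c \<noteq> 0}"
  proof (intro allI impI)
    fix q assume "n = 2*q+1"
    then show "{Orb \<in> coadjoint_orbits n. Orb \<subseteq> {\<xi>. \<xi> (2*q+1) \<noteq> 0}} =
          {{\<xi> \<in> Vn_dual n. \<xi> (2*q+1) = c} | c. c \<noteq> 0}"
      using odd_orbits[of "2*q+1"] by simp
  qed
  show "{Orb \<in> coadjoint_orbits n. Orb \<subseteq> {\<xi>. \<xi> n = 0}} = coadjoint_orbits (n - 1)"
    using assms by (intro orbits_in_wall) simp
qed

end
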